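(* Let $G=(V,E)$ be a geographic network with set of sites $K\subseteq V$, and let $s,t\in K$ be a pair of distinct sites. If there exist other sites $p,q\in K\setminus\{s,t\}$ such that $d(s,t)>2d(s,p)$ and $d(s,t)>2d(t,q)$, then for every vertex $v\in V$ the pair $(s,t)$ does not minimize the round-trip distance $D_P(v,(\cdot,\cdot))$ from $v$ among all pairs of distinct sites of $K$.
   Context: A geographic network $G=(V,E)$ is a finite undirected graph, with edges being unordered pairs of distinct vertices, together with a weight function assigning a non-negative real number to each edge. It is assumed that any two vertices are joined by a path. For vertices $v,w$, $d(v,w)$ denotes the length (total weight) of a shortest (minimum weight) path between $v$ and $w$. A subset $K\subseteq V$ of vertices is designated as the set of sites. For a vertex $v$ and a pair of distinct sites $(s,t)$, the (two-site) round-trip distance is $D_P(v,(s,t))=d(v,s)+d(v,t)+d(s,t)$. *)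

theory Defs
  imports Complex_Main
begin

text \<open>A path is given by the list of its vertices, which are pairwise distinct; the one-element
  list is the path of weight 0 from a vertex to itself.\<close>

definition is_path :: "'a set \<Rightarrow> 'a set set \<Rightarrow> 'a \<Rightarrow> 'a list \<Rightarrow> 'a \<Rightarrow> bool" where
  "is_path V E u xs v \<longleftrightarrow>
     xs \<noteq> [] \<and> hd xs = u \<and> last xs = v \<and> set xs \<subseteq> V \<and> distinct xs \<and>
     successively (\<lambda>x y. {x, y} \<in> E) xs"

definition path_weight :: "('a set \<Rightarrow> real) \<Rightarrow> 'a list \<Rightarrow> real" where
  "path_weight w xs = (\<Sum>(x, y) \<leftarrow> zip xs (tl xs). w {x, y})"

locale geographic_network =
  fixes V :: "'a set" and E :: "'a set set" and w :: "'a set \<Rightarrow> real"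
  assumes finite_vertices: "finite V"
    and edges: "E \<subseteq> {{u, v} | u v. u \<in> V \<and> v \<in> V \<and> u \<noteq> v}"
    and weight_nonneg: "e \<in> E \<Longrightarrow> 0 \<le> w e"
    and connected: "u \<in> V \<Longrightarrow> v \<in> V \<Longrightarrow> \<exists>xs. is_path V E u xs v"

text \<open>In a geographic network the set below is finite and nonempty for all vertices u, v
  (see the two lemmas that follow), so that Min is a genuine minimum.\<close>

definition net_dist :: "'a set \<Rightarrow> 'a set set \<Rightarrow> ('a set \<Rightarrow> real) \<Rightarrow> 'a \<Rightarrow> 'a \<Rightarrow> real" where
  "net_dist V E w u v = Min {path_weight w xs | xs. is_path V E u xs v}"

lemma (in geographic_network) finite_path_weights:
  "finite {path_weight w xs | xs. is_path V E u xs v}"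
proof -
  have "finite {xs. set xs \<subseteq> V \<and> distinct xs}"
    using finite_vertices by (rule finite_subset_distinct)
  then have "finite {xs. is_path V E u xs v}"
    by (rule rev_finite_subset) (auto simp: is_path_def)
  then show ?thesis by simp
qed

lemma (in geographic_network) path_weights_nonempty:
  "u \<in> V \<Longrightarrow> v \<in> V \<Longrightarrow> {path_weight w xs | xs. is_path V E u xs v} \<noteq> {}"
  using connected by blast

definition round_trip_dist ::
    "'a set \<Rightarrow> 'a set set \<Rightarrow> ('a set \<Rightarrow> real) \<Rightarrow> 'a \<Rightarrow> 'a \<times> 'a \<Rightarrow> real" where
  "round_trip_dist V E w v =
     (\<lambda>(s, t). net_dist V E w v s + net_dist V E w v t + net_dist V E w s t)"

definition site_pairs :: "'a set \<Rightarrow> ('a \<times> 'a) set" where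
  "site_pairs K = {(s, t). s \<in> K \<and> t \<in> K \<and> s \<noteq> t}"

end

theory Submission
  imports Defs
begin

text \<open>The pair (s, t) is beaten by replacing the farther of its two sites: if s is at least as close
  to v as t, then the detour from v through s to p costs at most d(v,s) + d(s,p), so (s, p) has
  round-trip distance at most 2 d(v,s) + 2 d(s,p) < d(v,s) + d(v,t) + d(s,t); otherwise (t, q) works
  in the same way. Only the triangle inequality is needed, which holds because a walk can be
  shortened to a path.\<close>

lemma path_weight_Cons:
  "xs \<noteq> [] \<Longrightarrow> path_weight w (x # xs) = w {x, hd xs} + path_weight w xs"
  by (cases xs) (auto simp: path_weight_def)

text \<open>The two parts share the vertex \<open>y\<close> but no consecutive pair, so every step
  is counted exactly once.\<close>

lemma path_weight_append:
  "path_weight w (xs @ y # ys) = path_weight w (xs @ [y]) + path_weight w (y # ys)"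
proof (induction xs)
  case Nil
  then show ?case by (simp add: path_weight_def)
next
  case (Cons x xs)
  have "hd (xs @ y # ys) = hd (xs @ [y])" by (cases xs) auto
  with Cons show ?case by (simp add: path_weight_Cons)
qed

context geographic_network
begin

text \<open>Weights are constrained on \<open>E\<close> only, hence the adjacency hypothesis.
  Distinctness is not demanded, so walks are covered as well.\<close>

lemma path_weight_nonneg:
  "successively (\<lambda>x y. {x, y} \<in> E) xs \<Longrightarrow> 0 \<le> path_weight w xs"
proof (induction xs)
  case Nil
  then show ?case by (simp add: path_weight_def)
next
  case (Cons x xs)
  show ?case
  proof (cases "xs = []")
    case True
    then show ?thesis by (simp add: path_weight_def)
  next
    case False
    with Cons show ?thesis
      using weight_nonneg[of "{x, hd xs}"] by (simp add: path_weight_Cons successively_Cons)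
  qed
qed

text \<open>Induction from the front of the walk: a path obtained for the tail is either extended by
  the new first vertex or, if it already visits that vertex, cut off there.\<close>

lemma walk_contains_path:
  assumes "xs \<noteq> []" "set xs \<subseteq> V" "successively (\<lambda>x y. {x, y} \<in> E) xs"
  obtains ys where "is_path V E (hd xs) ys (last xs)" "path_weight w ys \<le> path_weight w xs"
proof -
  have "\<exists>ys. is_path V E (hd xs) ys (last xs) \<and> path_weight w ys \<le> path_weight w xs"
    using assms
  proof (induction xs)
    case Nil
    then show ?case by simp
  next
    case (Cons x xs)
    show ?case
    proof (cases "xs = []")
      case True
      with Cons.prems show ?thesis by (intro exI[of _ "[x]"]) (simp add: is_path_def)
    next
      case False
      with Cons obtain ys where ys: "is_path V E (hd xs) ys (last xs)"
          "path_weight w ys \<le> path_weight w xs"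
        by (auto simp: successively_Cons)
      have edge: "{x, hd xs} \<in> E" using Cons.prems False by (simp add: successively_Cons)
      show ?thesis
      proof (cases "x \<in> set ys")
        case True
        then obtain as bs where split: "ys = as @ x # bs" by (meson split_list)
        have "is_path V E x (x # bs) (last xs)"
          using ys(1) by (auto simp: split is_path_def successively_append_iff)
        moreover have "0 \<le> path_weight w (as @ [x])"
          using ys(1) by (intro path_weight_nonneg)
            (auto simp: split is_path_def successively_append_iff)
        then have "path_weight w (x # bs) \<le> path_weight w ys"
          using path_weight_append[of w as x bs] by (simp add: split)
        ultimately show ?thesis
          using ys(2) False weight_nonneg[OF edge]
          by (intro exI[of _ "x # bs"]) (simp add: path_weight_Cons)
      next
        case False
        \<comment> \<open>Since \<open>ys\<close> starts at \<open>hd xs\<close>, the first edge of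
          the walk attaches \<open>x\<close> to it at the same cost.\<close>
        with ys Cons.prems \<open>xs \<noteq> []\<close> edge show ?thesis
          by (intro exI[of _ "x # ys"])
            (auto simp: is_path_def successively_Cons path_weight_Cons)
      qed
    qed
  qed
  then show thesis using that by blast
qed

lemma net_dist_le_path_weight:
  "is_path V E u xs v \<Longrightarrow> net_dist V E w u v \<le> path_weight w xs"
  unfolding net_dist_def by (intro Min_le finite_path_weights) blast

lemma shortest_path_exists:
  assumes "u \<in> V" "v \<in> V"
  obtains xs where "is_path V E u xs v" "path_weight w xs = net_dist V E w u v"
  using Min_in[OF finite_path_weights path_weights_nonempty[OF assms]]
  unfolding net_dist_def by auto

text \<open>Two shortest paths joined at \<open>b\<close> may have further vertices in common, so
  their union is only a walk and has to be shortened to a path.\<close>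

lemma net_dist_triangle:
  assumes "a \<in> V" "b \<in> V" "c \<in> V"
  shows "net_dist V E w a c \<le> net_dist V E w a b + net_dist V E w b c"
proof -
  obtain xs where xs: "is_path V E a xs b" "path_weight w xs = net_dist V E w a b"
    using assms shortest_path_exists by blast
  obtain ys where ys: "is_path V E b ys c" "path_weight w ys = net_dist V E w b c"
    using assms shortest_path_exists by blast
  \<comment> \<open>Exposing \<open>b\<close> at the end of \<open>xs\<close> and at the start of
    \<open>ys\<close> lets the joined walk contain the junction once, as
    \<open>path_weight_append\<close> expects.\<close>
  obtain as where as: "xs = as @ [b]"
    using xs(1) by (metis append_butlast_last_id is_path_def)
  obtain bs where bs: "ys = b # bs"
    using ys(1) by (metis list.collapse is_path_def)
  let ?zs = "as @ b # bs"
  have ends: "hd ?zs = a" "last ?zs = c"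
    using xs(1) ys(1) by (auto simp: as bs is_path_def hd_append)
  have "set ?zs \<subseteq> V" "successively (\<lambda>x y. {x, y} \<in> E) ?zs"
    using xs(1) ys(1) by (auto simp: as bs is_path_def successively_append_iff)
  then obtain zs where "is_path V E a zs c" "path_weight w zs \<le> path_weight w ?zs"
    using walk_contains_path[of ?zs] ends by auto
  then show ?thesis
    using net_dist_le_path_weight[of a zs c] path_weight_append[of w as b bs] xs(2) ys(2) as bs
    by simp
qed

text \<open>The number \<open>d\<close> stands for the distance between the two sites. Keeping it
  abstract lets the lemma be applied with the sites exchanged without appealing to symmetry of
  \<open>net_dist\<close>.\<close>

lemma round_trip_dist_closer_site_less:
  assumes "v \<in> V" "s \<in> V" "p \<in> V"
    and "net_dist V E w v s \<le> net_dist V E w v t" "2 * net_dist V E w s p < d"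
  shows "round_trip_dist V E w v (s, p) < net_dist V E w v s + net_dist V E w v t + d"
  using net_dist_triangle[OF assms(1-3)] assms(4,5) by (simp add: round_trip_dist_def)

end

theorem lemma3:
  fixes V :: "'a set" and E :: "'a set set" and w :: "'a set \<Rightarrow> real"
    and K :: "'a set" and s t :: 'a
  assumes "geographic_network V E w"
    and "K \<subseteq> V"
    and "s \<in> K" and "t \<in> K" and "s \<noteq> t"
    and "\<exists>p \<in> K - {s, t}. \<exists>q \<in> K - {s, t}.
           net_dist V E w s t > 2 * net_dist V E w s p \<and>
           net_dist V E w s t > 2 * net_dist V E w t q"
  shows "\<forall>v \<in> V. \<not> is_arg_min (round_trip_dist V E w v) (\<lambda>P. P \<in> site_pairs K) (s, t)"
proof
  interpret geographic_network V E w by fact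
  fix v assume v: "v \<in> V"
  obtain p q where p: "p \<in> K - {s, t}" "2 * net_dist V E w s p < net_dist V E w s t"
    and q: "q \<in> K - {s, t}" "2 * net_dist V E w t q < net_dist V E w s t"
    using assms(6) by auto
  have "\<exists>P \<in> site_pairs K. round_trip_dist V E w v P < round_trip_dist V E w v (s, t)"
  proof (cases "net_dist V E w v s \<le> net_dist V E w v t")
    case True
    then have "round_trip_dist V E w v (s, p) < round_trip_dist V E w v (s, t)"
      using round_trip_dist_closer_site_less[of v s p t] v p assms(2,3)
      by (auto simp: round_trip_dist_def)
    moreover have "(s, p) \<in> site_pairs K"
      using p assms(3) by (auto simp: site_pairs_def)
    ultimately show ?thesis by blast
  next
    case False
    \<comment> \<open>Here \<open>t\<close> is the closer site, while \<open>d\<close> is still the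
      distance from \<open>s\<close> to \<open>t\<close>.\<close>
    then have "round_trip_dist V E w v (t, q) < round_trip_dist V E w v (s, t)"
      using round_trip_dist_closer_site_less[of v t q s "net_dist V E w s t"] v q assms(2,4)
      by (auto simp: round_trip_dist_def)
    moreover have "(t, q) \<in> site_pairs K"
      using q assms(4) by (auto simp: site_pairs_def)
    ultimately show ?thesis by blast
  qed
  then show "\<not> is_arg_min (round_trip_dist V E w v) (\<lambda>P. P \<in> site_pairs K) (s, t)"
    by (auto simp: is_arg_min_def)
qed

end
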